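(* Let $A$ be a commutative Fréchet algebra and let $M$ be a commutative Fréchet $A$-module, with topologies defined by increasing sequences of seminorms, both denoted $(p_k)_{k\ge 1}$, as described in the context. Let $\mathcal{U}=A\oplus M$ be the commutative algebra with coordinatewise linear operations and product $(a,x)(b,y)=(ab,\ a\cdot y+b\cdot x)$ for $a,b\in A$, $x,y\in M$. Let $D:A\to M$ be a derivation, not assumed continuous. For $k\ge 1$, $a\in A$, $x\in M$ set $$q_k((a,x))=p_k(a)+p_k(x),\qquad q_{k,D}((a,x))=p_k(a)+p_k(D(a)-x).$$ Then $\mathcal{U}$ is a Fréchet algebra with respect to the topology generated by $(q_k)_{k\ge1}$, and also with respect to the topology generated by $(q_{k,D})_{k\ge1}$. These two topologies are equivalent if and only if $D$ is continuous.
   Context: All algebras are complex. A Fréchet algebra is an algebra with a complete metrizable locally convex topology that can be defined by an increasing sequence of submultiplicative seminorms. A commutative Fréchet $A$-module $M$ is a Fréchet space that is a commutative $A$-module (that is, an $A$-bimodule in which left and right actions coincide, over the commutative algebra $A$) such that $(a,x)\mapsto a\cdot x$ is continuous from $A\times M$ to $M$. The seminorms $p_k$ on $A$ are submultiplicative and define the topology of $A$; the seminorms $p_k$ on $M$ define the topology of $M$; and for each $k$ there is a constant $l_k\ge 1$ with $p_k(a\cdot x)\le l_k\,p_k(a)\,p_k(x)$ for all $a\in A$, $x\in M$. A derivation $D:A\to M$ is a linear map with $D(ab)=a\cdot D(b)+b\cdot D(a)$ for all $a,b\in A$. Two topologies on $\mathcal{U}$ are equivalent if they coincide. *)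

theory Defs
  imports "HOL-Analysis.Analysis"
begin

text \<open>
  Complex vector spaces are types of class \<^class>\<open>ab_group_add\<close> with an explicit scalar
  multiplication satisfying \<^locale>\<open>vector_space\<close>. The multiplication of an algebra is explicit
  as well, because the product type carries the multiplication of the trivial extension below.
  Algebras are not assumed to be unital.
\<close>

locale complex_algebra = vector_space scl
  for scl :: "complex \<Rightarrow> 'a::ab_group_add \<Rightarrow> 'a" +
  fixes mul :: "'a \<Rightarrow> 'a \<Rightarrow> 'a"
  assumes mult_assoc: "mul (mul a b) c = mul a (mul b c)"
    and mult_add_left: "mul (a + b) c = mul a c + mul b c"
    and mult_add_right: "mul a (b + c) = mul a b + mul a c"
    and mult_scale_left: "mul (scl z a) b = scl z (mul a b)"
    and mult_scale_right: "mul a (scl z b) = scl z (mul a b)"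

locale comm_complex_algebra = complex_algebra +
  assumes mult_commute: "mul a b = mul b a"

text \<open>
  A commutative bimodule over a commutative algebra is determined by its left action.
\<close>

locale comm_algebra_module =
  A: comm_complex_algebra scaleA mul + M: vector_space scaleM
  for scaleA :: "complex \<Rightarrow> 'a::ab_group_add \<Rightarrow> 'a"
    and mul :: "'a \<Rightarrow> 'a \<Rightarrow> 'a"
    and scaleM :: "complex \<Rightarrow> 'm::ab_group_add \<Rightarrow> 'm" +
  fixes act :: "'a \<Rightarrow> 'm \<Rightarrow> 'm"
  assumes act_mult: "act (mul a b) x = act a (act b x)"
    and act_add_left: "act (a + b) x = act a x + act b x"
    and act_add_right: "act a (x + y) = act a x + act a y"
    and act_scale_left: "act (scaleA z a) x = scaleM z (act a x)"
    and act_scale_right: "act a (scaleM z x) = scaleM z (act a x)"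

definition seminorm :: "(complex \<Rightarrow> 'v::ab_group_add \<Rightarrow> 'v) \<Rightarrow> ('v \<Rightarrow> real) \<Rightarrow> bool" where
  "seminorm scl p \<longleftrightarrow>
     (\<forall>x. 0 \<le> p x) \<and> (\<forall>x y. p (x + y) \<le> p x + p y) \<and> (\<forall>z x. p (scl z x) = cmod z * p x)"

definition submultiplicative :: "('a \<Rightarrow> 'a \<Rightarrow> 'a) \<Rightarrow> ('a \<Rightarrow> real) \<Rightarrow> bool" where
  "submultiplicative mul p \<longleftrightarrow> (\<forall>a b. p (mul a b) \<le> p a * p b)"

definition seminorm_topology :: "(nat \<Rightarrow> 'v::ab_group_add \<Rightarrow> real) \<Rightarrow> 'v topology" where
  "seminorm_topology p = topology_generated_by {{y. p k (y - x) < r} | k x r. 0 < r}"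

text \<open>
  In a topological vector space, completeness and metrizability together mean that the topology
  is induced by a complete translation-invariant metric.
\<close>

locale frechet_space = vector_space scl
  for scl :: "complex \<Rightarrow> 'v::ab_group_add \<Rightarrow> 'v" +
  fixes T :: "'v topology"
  assumes topspace_UNIV: "topspace T = UNIV"
    and continuous_add: "continuous_map (prod_topology T T) T (\<lambda>(x, y). x + y)"
    and continuous_scale: "continuous_map (prod_topology euclidean T) T (\<lambda>(z, x). scl z x)"
    and locally_convex:
      "\<And>W. openin T W \<Longrightarrow> 0 \<in> W \<Longrightarrow>
         \<exists>C. openin T C \<and> 0 \<in> C \<and> C \<subseteq> W \<and>
           (\<forall>x\<in>C. \<forall>y\<in>C. \<forall>t\<in>{0..1::real}.
              scl (of_real (1 - t)) x + scl (of_real t) y \<in> C)"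
    and complete_metrizable:
      "\<exists>d. Metric_space UNIV d \<and> (\<forall>x y z. d (x + z) (y + z) = d x y) \<and>
         Metric_space.mtopology UNIV d = T \<and> Metric_space.mcomplete UNIV d"

locale frechet_algebra = complex_algebra scl mul + frechet_space scl T
  for scl :: "complex \<Rightarrow> 'a::ab_group_add \<Rightarrow> 'a" and mul T +
  assumes submultiplicative_seminorms:
    "\<exists>p. mono p \<and> (\<forall>k. seminorm scl (p k) \<and> submultiplicative mul (p k)) \<and>
         T = seminorm_topology p"

locale comm_frechet_algebra = frechet_algebra scl mul T + comm_complex_algebra scl mul
  for scl :: "complex \<Rightarrow> 'a::ab_group_add \<Rightarrow> 'a" and mul T

locale comm_frechet_module =
  comm_algebra_module scaleA mul scaleM act + A: comm_frechet_algebra scaleA mul TA +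
  M: frechet_space scaleM TM
  for scaleA :: "complex \<Rightarrow> 'a::ab_group_add \<Rightarrow> 'a" and mul TA
    and scaleM :: "complex \<Rightarrow> 'm::ab_group_add \<Rightarrow> 'm" and act TM +
  assumes continuous_act: "continuous_map (prod_topology TA TM) TM (\<lambda>(a, x). act a x)"

definition derivation ::
    "(complex \<Rightarrow> 'a::ab_group_add \<Rightarrow> 'a) \<Rightarrow> ('a \<Rightarrow> 'a \<Rightarrow> 'a) \<Rightarrow>
     (complex \<Rightarrow> 'm::ab_group_add \<Rightarrow> 'm) \<Rightarrow> ('a \<Rightarrow> 'm \<Rightarrow> 'm) \<Rightarrow> ('a \<Rightarrow> 'm) \<Rightarrow> bool" where
  "derivation scaleA mul scaleM act D \<longleftrightarrow>
     Vector_Spaces.linear scaleA scaleM D \<and>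
     (\<forall>a b. D (mul a b) = act a (D b) + act b (D a))"

text \<open>
  The algebra \<open>A \<oplus> M\<close> lives on the product type, whose additive structure is coordinatewise.
\<close>

definition ext_scale ::
    "(complex \<Rightarrow> 'a \<Rightarrow> 'a) \<Rightarrow> (complex \<Rightarrow> 'm \<Rightarrow> 'm) \<Rightarrow> complex \<Rightarrow> 'a \<times> 'm \<Rightarrow> 'a \<times> 'm" where
  "ext_scale scaleA scaleM = (\<lambda>z (a, x). (scaleA z a, scaleM z x))"

definition ext_mult ::
    "('a \<Rightarrow> 'a \<Rightarrow> 'a) \<Rightarrow> ('a \<Rightarrow> 'm::ab_group_add \<Rightarrow> 'm) \<Rightarrow> 'a \<times> 'm \<Rightarrow> 'a \<times> 'm \<Rightarrow> 'a \<times> 'm" where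
  "ext_mult mul act = (\<lambda>(a, x) (b, y). (mul a b, act a y + act b x))"

lemma comm_complex_algebra_ext:
  assumes "comm_algebra_module scaleA mul scaleM act"
  shows "comm_complex_algebra (ext_scale scaleA scaleM) (ext_mult mul act)"
proof -
  interpret comm_algebra_module scaleA mul scaleM act by fact
  have act_swap: "act a (act b x) = act b (act a x)" for a b x
    by (metis A.mult_commute act_mult)
  have mult_left_commute: "mul a (mul b c) = mul b (mul a c)" for a b c
    by (metis A.mult_commute A.mult_assoc)
  show ?thesis
    by unfold_locales
      (auto simp: ext_scale_def ext_mult_def A.scale_right_distrib A.scale_left_distrib
        M.scale_right_distrib M.scale_left_distrib act_mult act_add_left act_add_right
        act_scale_left act_scale_right A.mult_assoc A.mult_add_left A.mult_add_right
        A.mult_scale_left A.mult_scale_right A.mult_commute mult_left_commute add_ac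
        act_swap)
qed

definition ext_seminorm ::
    "(nat \<Rightarrow> 'a \<Rightarrow> real) \<Rightarrow> (nat \<Rightarrow> 'm \<Rightarrow> real) \<Rightarrow> nat \<Rightarrow> 'a \<times> 'm \<Rightarrow> real" where
  "ext_seminorm pA pM k = (\<lambda>(a, x). pA k a + pM k x)"

definition ext_seminorm_deriv ::
    "(nat \<Rightarrow> 'a \<Rightarrow> real) \<Rightarrow> (nat \<Rightarrow> 'm::ab_group_add \<Rightarrow> real) \<Rightarrow> ('a \<Rightarrow> 'm) \<Rightarrow>
     nat \<Rightarrow> 'a \<times> 'm \<Rightarrow> real" where
  "ext_seminorm_deriv pA pM D k = (\<lambda>(a, x). pA k a + pM k (D a - x))"

end

theory Submission
  imports Defs
begin

text \<open>
  The map \<open>\<phi> (a, x) = (a, D a - x)\<close> is an involutive automorphism of the algebra \<open>A \<oplus> M\<close>, and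
  \<open>q\<^bsub>k,D\<^esub> = q\<^sub>k \<circ> \<phi>\<close>. Hence the second topology is the pullback of the first, which is the
  product topology, along an algebra automorphism, and so again a Frechet algebra topology. The
  two topologies coincide iff \<open>\<phi>\<close> is continuous for the first one, that is, iff \<open>D\<close> is continuous.
  Rescaling the first summand of \<open>q\<^sub>k\<close> by \<open>max\<^bsub>i\<le>k\<^esub> l\<^sub>i\<close> makes it submultiplicative.
\<close>

section \<open>Topology of an increasing sequence of seminorms\<close>

locale seminorm_family = vector_space scl
  for scl :: "complex \<Rightarrow> 'v::ab_group_add \<Rightarrow> 'v" +
  fixes p :: "nat \<Rightarrow> 'v \<Rightarrow> real"
  assumes mono_p: "mono p"
    and seminorm_p: "seminorm scl (p k)"
begin

lemma nonneg: "0 \<le> p k x"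
  and triangle: "p k (x + y) \<le> p k x + p k y"
  and scale: "p k (scl z x) = cmod z * p k x"
  using seminorm_p[of k] by (auto simp: seminorm_def)

lemma zero [simp]: "p k 0 = 0"
  using scale[of k 0 0] by simp

lemma minus [simp]: "p k (- x) = p k x"
  using scale[of k "-1" x] by simp

lemma triangle_diff: "p k (x - y) \<le> p k x + p k y"
  using triangle[of k x "- y"] by simp

lemma mono_index: "i \<le> j \<Longrightarrow> p i x \<le> p j x"
  using mono_p by (auto simp: mono_def le_fun_def)

lemma openin_ball: "0 < r \<Longrightarrow> openin (seminorm_topology p) {y. p k (y - x) < r}"
  unfolding seminorm_topology_def by (rule topology_generated_by_Basis) auto

text \<open>The generating balls, whose centres are arbitrary, are a priori only a subbasis. They
  form a basis because the family is increasing: the seminorm of index \<open>max k j\<close>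
  dominates those of index \<open>k\<close> and \<open>j\<close>, so one ball about a point fits
  into two given ones. Every later argument about open sets goes through this criterion.\<close>

lemma openin_iff:
  "openin (seminorm_topology p) W \<longleftrightarrow>
     (\<forall>x\<in>W. \<exists>k r. 0 < r \<and> {y. p k (y - x) < r} \<subseteq> W)" (is "_ \<longleftrightarrow> ?R W")
proof
  assume "openin (seminorm_topology p) W"
  then have "generate_topology_on {{y. p k (y - x) < r} | k x r. 0 < r} W"
    unfolding seminorm_topology_def by (simp add: openin_topology_generated_by_iff)
  then show "?R W"
  proof induction
    case (Int U V)
    show ?case
    proof
      fix x assume "x \<in> U \<inter> V"
      then obtain k r j s where *: "0 < r" "{y. p k (y - x) < r} \<subseteq> U"
        "0 < s" "{y. p j (y - x) < s} \<subseteq> V"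
        using Int.IH by blast
      have "{y. p (max k j) (y - x) < min r s} \<subseteq> U \<inter> V"
        using *(2,4) mono_index[of k "max k j"] mono_index[of j "max k j"]
        by (fastforce intro: le_less_trans)
      then show "\<exists>k r. 0 < r \<and> {y. p k (y - x) < r} \<subseteq> U \<inter> V"
        using *(1,3) by (metis min_less_iff_conj)
    qed
  next
    case (UN K)
    then show ?case by (meson Sup_upper UnionE order_trans)
  next
    case (Basis s)
    then obtain k x r where s: "s = {y. p k (y - x) < r}" by auto
    show ?case
    proof
      fix u assume "u \<in> s"
      \<comment> \<open>A generating ball is centred at \<open>x\<close>, but the criterion asks for
        one centred at \<open>u\<close>. The radius left over after moving from \<open>x\<close> to
        \<open>u\<close> is \<open>r - p k (u - x)\<close>.\<close>
      have "p k (y - x) < r" if "p k (y - u) < r - p k (u - x)" for y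
        using triangle[of k "y - u" "u - x"] that by simp
      then have "{y. p k (y - u) < r - p k (u - x)} \<subseteq> s"
        unfolding s by blast
      then show "\<exists>k r. 0 < r \<and> {y. p k (y - u) < r} \<subseteq> s"
        using \<open>u \<in> s\<close>
        by (intro exI[of _ k] exI[of _ "r - p k (u - x)"]) (simp add: s)
    qed
  qed auto
next
  assume R: "?R W"
  have "\<exists>U. openin (seminorm_topology p) U \<and> x \<in> U \<and> U \<subseteq> W" if x: "x \<in> W" for x
  proof -
    obtain k r where "0 < r" "{y. p k (y - x) < r} \<subseteq> W"
      using R x by blast
    then show ?thesis
      using openin_ball[of r k x] by (intro exI[of _ "{y. p k (y - x) < r}"]) auto
  qed
  then show "openin (seminorm_topology p) W"
    by (subst openin_subopen) blast
qed

lemma topspace_seminorm_topology [simp]: "topspace (seminorm_topology p) = UNIV"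
proof -
  have "openin (seminorm_topology p) UNIV"
    unfolding openin_iff by (auto intro: exI[of _ 1])
  then show ?thesis
    using openin_subset by blast
qed

lemma continuous_map_add:
  "continuous_map (prod_topology (seminorm_topology p) (seminorm_topology p))
     (seminorm_topology p) (\<lambda>(x, y). x + y)"
  unfolding continuous_map_def
proof (intro conjI allI impI)
  fix W assume W: "openin (seminorm_topology p) W"
  show "openin (prod_topology (seminorm_topology p) (seminorm_topology p))
      {u \<in> topspace (prod_topology (seminorm_topology p) (seminorm_topology p)).
         (case u of (x, y) \<Rightarrow> x + y) \<in> W}"
    unfolding openin_prod_topology_alt
  proof (intro allI impI)
    fix x y
    assume "(x, y) \<in> {u \<in> topspace (prod_topology (seminorm_topology p) (seminorm_topology p)).
         (case u of (x, y) \<Rightarrow> x + y) \<in> W}"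
    then obtain k r where r: "0 < r" "{z. p k (z - (x + y)) < r} \<subseteq> W"
      using W unfolding openin_iff by fastforce
    define s where "s = r / 2"
    have s: "0 < s" "s + s = r"
      using r(1) by (auto simp: s_def)
    have "u + v \<in> W" if "p k (u - x) < s" "p k (v - y) < s" for u v
    proof -
      have "p k ((u - x) + (v - y)) < r"
        using triangle[of k "u - x" "v - y"] that s by linarith
      then show ?thesis using r(2) by (auto simp: algebra_simps)
    qed
    then show "\<exists>U V. openin (seminorm_topology p) U \<and> openin (seminorm_topology p) V \<and>
        x \<in> U \<and> y \<in> V \<and>
        U \<times> V \<subseteq> {u \<in> topspace (prod_topology (seminorm_topology p) (seminorm_topology p)).
         (case u of (x, y) \<Rightarrow> x + y) \<in> W}"
      using openin_ball[OF s(1), of k x] openin_ball[OF s(1), of k y] s(1)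
      by - (rule exI[of _ "{u. p k (u - x) < s}"], rule exI[of _ "{v. p k (v - y) < s}"], auto)
  qed
qed auto

lemma continuous_map_scale:
  "continuous_map (prod_topology euclidean (seminorm_topology p))
     (seminorm_topology p) (\<lambda>(z, x). scl z x)"
  unfolding continuous_map_def
proof (intro conjI allI impI)
  fix W assume W: "openin (seminorm_topology p) W"
  show "openin (prod_topology euclidean (seminorm_topology p))
      {u \<in> topspace (prod_topology euclidean (seminorm_topology p)).
         (case u of (z, x) \<Rightarrow> scl z x) \<in> W}"
    unfolding openin_prod_topology_alt
  proof (intro allI impI)
    fix z x
    assume "(z, x) \<in> {u \<in> topspace (prod_topology euclidean (seminorm_topology p)).
         (case u of (z, x) \<Rightarrow> scl z x) \<in> W}"
    then obtain k r where r: "0 < r" "{y. p k (y - scl z x) < r} \<subseteq> W"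
      using W unfolding openin_iff by fastforce
    \<comment> \<open>The estimate rests on
      \<open>scl w y - scl z x = scl w (y - x) + scl (w - z) x\<close>, each term taking half of
      \<open>r\<close>. The cap 1 in \<delta> gives \<open>cmod w \<le> cmod z + 1\<close>, the
      factor in the denominator of \<eta>. The added 1 in the denominator of \<delta> avoids
      division by zero where \<open>p k x = 0\<close>.\<close>
    define \<delta> where "\<delta> = min 1 (r / (2 * (p k x + 1)))"
    define \<eta> where "\<eta> = r / (2 * (cmod z + 1))"
    have pos: "0 < \<delta>" "0 < \<eta>"
      using r(1) nonneg[of k x] by (auto simp: \<delta>_def \<eta>_def add_nonneg_pos)
    have "scl w y \<in> W" if "cmod (w - z) < \<delta>" "p k (y - x) < \<eta>" for w y
    proof -
      have "cmod w \<le> cmod z + 1"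
        using that(1) norm_triangle_ineq[of z "w - z"] by (simp add: \<delta>_def)
      then have "cmod w * p k (y - x) \<le> (cmod z + 1) * p k (y - x)"
        by (simp add: mult_right_mono nonneg)
      also have "\<dots> < (cmod z + 1) * \<eta>"
        using that(2) by (simp add: mult_strict_left_mono add_nonneg_pos)
      also have "\<dots> = r / 2"
      proof -
        have "2 * cmod z + 2 \<noteq> 0"
          using norm_ge_zero[of z] by linarith
        then show ?thesis by (simp add: \<eta>_def divide_simps)
      qed
      finally have 1: "cmod w * p k (y - x) < r / 2" .
      have "cmod (w - z) * p k x \<le> \<delta> * (p k x + 1)"
        using that(1) nonneg[of k x] pos by (intro mult_mono) auto
      also have "\<dots> \<le> r / (2 * (p k x + 1)) * (p k x + 1)"
        using nonneg[of k x] by (intro mult_right_mono) (auto simp: \<delta>_def)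
      also have "\<dots> = r / 2"
        using nonneg[of k x] by (simp add: field_simps)
      finally have 2: "cmod (w - z) * p k x \<le> r / 2" .
      have "scl w y - scl z x = scl w (y - x) + scl (w - z) x"
        by (simp add: scale_right_diff_distrib scale_left_diff_distrib)
      then have "p k (scl w y - scl z x) < r"
        using triangle[of k "scl w (y - x)" "scl (w - z) x"] 1 2 by (simp add: scale)
      then show ?thesis using r(2) by auto
    qed
    then show "\<exists>U V. openin euclidean U \<and> openin (seminorm_topology p) V \<and>
        z \<in> U \<and> x \<in> V \<and>
        U \<times> V \<subseteq> {u \<in> topspace (prod_topology euclidean (seminorm_topology p)).
         (case u of (z, x) \<Rightarrow> scl z x) \<in> W}"
      using pos
      by (intro exI[of _ "ball z \<delta>"] exI[of _ "{y. p k (y - x) < \<eta>}"])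
        (auto intro!: openin_ball simp: dist_norm norm_minus_commute)
  qed
qed auto

lemma convex_neighbourhood:
  assumes "openin (seminorm_topology p) W" "0 \<in> W"
  shows "\<exists>C. openin (seminorm_topology p) C \<and> 0 \<in> C \<and> C \<subseteq> W \<and>
           (\<forall>x\<in>C. \<forall>y\<in>C. \<forall>t\<in>{0..1::real}.
              scl (of_real (1 - t)) x + scl (of_real t) y \<in> C)"
proof -
  obtain k r where r: "0 < r" "{y. p k y < r} \<subseteq> W"
    using assms unfolding openin_iff by fastforce
  have "p k (scl (of_real (1 - t)) x + scl (of_real t) y) < r"
    if "p k x < r" "p k y < r" "t \<in> {0..1::real}" for x y t
  proof -
    have "p k (scl (of_real (1 - t)) x + scl (of_real t) y) \<le> (1 - t) * p k x + t * p k y"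
      using triangle[of k "scl (of_real (1 - t)) x" "scl (of_real t) y"] that(3)
      unfolding scale norm_of_real by simp
    also have "\<dots> < r"
      by (rule convex_bound_lt) (use that in auto)
    finally show ?thesis .
  qed
  moreover have "openin (seminorm_topology p) {y. p k y < r}"
    using openin_ball[OF r(1), of k 0] by simp
  ultimately show ?thesis
    using r by (intro exI[of _ "{y. p k y < r}"]) auto
qed

text \<open>The vector space operations are continuous and small balls about 0 are convex for every
  such family. Separation and completeness can fail, so these must come from a metric.\<close>

lemma frechet_spaceI:
  assumes "Metric_space UNIV d" "\<And>x y z. d (x + z) (y + z) = d x y"
    and "Metric_space.mtopology UNIV d = seminorm_topology p" "Metric_space.mcomplete UNIV d"
  shows "frechet_space scl (seminorm_topology p)"
proof unfold_locales
  show "\<exists>d. Metric_space UNIV d \<and> (\<forall>x y z. d (x + z) (y + z) = d x y) \<and>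
      Metric_space.mtopology UNIV d = seminorm_topology p \<and> Metric_space.mcomplete UNIV d"
    using assms by blast
qed (use continuous_map_add continuous_map_scale convex_neighbourhood in auto)

end

section \<open>Continuity of additive maps and comparison of seminorm topologies\<close>

lemma continuous_map_seminorm_topology:
  assumes "seminorm_family scl p" "seminorm_family scl' p'"
    and diff: "\<And>x y. f (x - y) = f x - f y"
  shows "continuous_map (seminorm_topology p) (seminorm_topology p') f \<longleftrightarrow>
    (\<forall>k r. 0 < r \<longrightarrow> (\<exists>j s. 0 < s \<and> (\<forall>x. p j x < s \<longrightarrow> p' k (f x) < r)))" (is "?L \<longleftrightarrow> ?R")
proof -
  interpret P: seminorm_family scl p by fact
  interpret P': seminorm_family scl' p' by fact
  have f0: "f 0 = 0" using diff[of 0 0] by simp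
  show ?thesis
  proof
    assume L: ?L
    show ?R
    proof (intro allI impI)
      fix k and r :: real assume r: "0 < r"
      \<comment> \<open>This preimage of a ball about 0 contains 0, since \<open>f 0 = 0\<close>.
        Openness at that point yields \<open>j\<close> and \<open>s\<close>.\<close>
      have "openin (seminorm_topology p) {x. p' k (f x) < r}"
        using openin_continuous_map_preimage[OF L P'.openin_ball[OF r, of k 0]] by simp
      then have "\<exists>j s. 0 < s \<and> {x. p j (x - 0) < s} \<subseteq> {x. p' k (f x) < r}"
        unfolding P.openin_iff by (rule bspec) (simp add: r f0)
      then show "\<exists>j s. 0 < s \<and> (\<forall>x. p j x < s \<longrightarrow> p' k (f x) < r)"
        by (simp add: subset_iff)
    qed
  next
    assume R: ?R
    show ?L
      unfolding continuous_map_def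
    proof (intro conjI allI impI)
      fix W assume W: "openin (seminorm_topology p') W"
      show "openin (seminorm_topology p) {x \<in> topspace (seminorm_topology p). f x \<in> W}"
        unfolding P.openin_iff
      proof
        fix x assume "x \<in> {x \<in> topspace (seminorm_topology p). f x \<in> W}"
        then obtain k r where r: "0 < r" "{y. p' k (y - f x) < r} \<subseteq> W"
          using W unfolding P'.openin_iff by fastforce
        then obtain j s where s: "0 < s" "\<And>x. p j x < s \<Longrightarrow> p' k (f x) < r"
          using R by metis
        \<comment> \<open>Additivity turns the estimate at 0 into one at \<open>x\<close>: it is
          applied to \<open>y - x\<close>, and \<open>f (y - x) = f y - f x\<close>.\<close>
        have "{y. p j (y - x) < s} \<subseteq> {x \<in> topspace (seminorm_topology p). f x \<in> W}"
          using s(2) r(2) diff by fastforce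
        then show "\<exists>j s. 0 < s \<and>
            {y. p j (y - x) < s} \<subseteq> {x \<in> topspace (seminorm_topology p). f x \<in> W}"
          using s(1) by blast
      qed
    qed auto
  qed
qed

text \<open>Two topologies on the same set agree exactly when the identity is continuous in both
  directions, and the identity is additive.\<close>

lemma seminorm_topology_eq_iff:
  fixes p p' :: "nat \<Rightarrow> 'v::ab_group_add \<Rightarrow> real"
  assumes "seminorm_family scl p" "seminorm_family scl p'"
  shows "seminorm_topology p = seminorm_topology p' \<longleftrightarrow>
    (\<forall>k r. 0 < r \<longrightarrow> (\<exists>j s. 0 < s \<and> (\<forall>x. p j x < s \<longrightarrow> p' k x < r))) \<and>
    (\<forall>k r. 0 < r \<longrightarrow> (\<exists>j s. 0 < s \<and> (\<forall>x. p' j x < s \<longrightarrow> p k x < r)))"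
proof -
  interpret P: seminorm_family scl p by fact
  interpret P': seminorm_family scl p' by fact
  have "seminorm_topology p = seminorm_topology p' \<longleftrightarrow>
      continuous_map (seminorm_topology p) (seminorm_topology p') (\<lambda>x. x) \<and>
      continuous_map (seminorm_topology p') (seminorm_topology p) (\<lambda>x. x)"
    by (auto simp: continuous_map_def topology_eq)
  then show ?thesis
    by (simp add: continuous_map_seminorm_topology[OF assms]
        continuous_map_seminorm_topology[OF assms(2,1)])
qed

text \<open>Of the two conditions for equality, the first is literally continuity of \<phi>. The
  second is the first with \<open>\<phi> x\<close> in place of \<open>x\<close>, because \<phi> is
  its own inverse, so one-sided continuity is enough.\<close>

lemma seminorm_topology_involution_eq_iff:
  assumes "seminorm_family scl p" "seminorm_family scl (\<lambda>k x. p k (\<phi> x))"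
    and diff: "\<And>x y. \<phi> (x - y) = \<phi> x - \<phi> y" and inv: "\<And>x. \<phi> (\<phi> x) = x"
  shows "seminorm_topology p = seminorm_topology (\<lambda>k x. p k (\<phi> x)) \<longleftrightarrow>
    continuous_map (seminorm_topology p) (seminorm_topology p) \<phi>"
  unfolding seminorm_topology_eq_iff[OF assms(1,2)]
    continuous_map_seminorm_topology[of scl p scl p \<phi>, OF assms(1,1) diff]
  by (metis inv)

section \<open>Transport of metrics, topologies and Frechet algebras along bijections\<close>

lemma Metric_space_pullback:
  assumes "Metric_space UNIV d" "inj f"
  shows "Metric_space UNIV (\<lambda>x y. d (f x) (f y))"
proof -
  interpret Metric_space UNIV d by fact
  show ?thesis
    by unfold_locales (use assms(2) triangle in \<open>auto simp: commute inj_eq\<close>)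
qed

text \<open>By construction \<open>f\<close> is an isometry onto the space with metric
  \<open>d\<close>, so it preserves Cauchy sequences. Surjectivity provides a preimage of the
  limit.\<close>

lemma mcomplete_pullback:
  assumes "Metric_space UNIV d" "bij f" "Metric_space.mcomplete UNIV d"
  shows "Metric_space.mcomplete UNIV (\<lambda>x y. d (f x) (f y))"
proof -
  interpret Metric_space UNIV d by fact
  interpret F: Metric_space UNIV "\<lambda>x y. d (f x) (f y)"
    by (rule Metric_space_pullback[OF assms(1) bij_is_inj[OF assms(2)]])
  show ?thesis
    unfolding F.mcomplete_def
  proof (intro allI impI)
    fix \<sigma> assume "F.MCauchy \<sigma>"
    then have "MCauchy (f \<circ> \<sigma>)"
      by (auto simp: MCauchy_def F.MCauchy_def)
    then obtain y where y: "limitin mtopology (f \<circ> \<sigma>) y sequentially"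
      using assms(3) unfolding mcomplete_def by blast
    obtain x where "y = f x" using assms(2) by (metis bij_pointE)
    then show "\<exists>x. limitin F.mtopology \<sigma> x sequentially"
      using y by (auto simp: limitin_metric F.limitin_metric)
  qed
qed

lemma mtopology_pullback:
  assumes "Metric_space UNIV d" "bij f"
    and "seminorm_family scl p" "seminorm_family scl' (\<lambda>k x. p k (f x))"
    and diff: "\<And>x y. f (x - y) = f x - f y"
    and top: "Metric_space.mtopology UNIV d = seminorm_topology p"
  shows "Metric_space.mtopology UNIV (\<lambda>x y. d (f x) (f y)) = seminorm_topology (\<lambda>k x. p k (f x))"
proof -
  interpret Metric_space UNIV d by fact
  interpret F: Metric_space UNIV "\<lambda>x y. d (f x) (f y)"
    by (rule Metric_space_pullback[OF assms(1) bij_is_inj[OF assms(2)]])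
  interpret P: seminorm_family scl p by fact
  interpret PF: seminorm_family scl' "\<lambda>k x. p k (f x)" by fact
  have f_inv: "f (inv f y) = y" for y
    using assms(2) by (simp add: bij_is_surj surj_f_inv_f)
  have ball: "{y. p k (f (y - x)) < r} \<subseteq> W \<longleftrightarrow> {y. p k (y - f x) < r} \<subseteq> f ` W" for k r x W
  proof -
    have "f ` {y. p k (f (y - x)) < r} = {y. p k (y - f x) < r}"
      by (auto simp: image_iff diff f_inv intro!: exI[of _ "inv f _"])
    then show ?thesis
      using assms(2) by (metis bij_is_inj inj_image_subset_iff)
  qed
  have mball: "F.mball x r \<subseteq> W \<longleftrightarrow> mball (f x) r \<subseteq> f ` W" for x r W
  proof -
    have "f ` F.mball x r = mball (f x) r"
      by (auto simp: image_iff f_inv intro!: bexI[of _ "inv f _"])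
    then show ?thesis
      using assms(2) by (metis bij_is_inj inj_image_subset_iff)
  qed
  have "openin F.mtopology W \<longleftrightarrow> openin mtopology (f ` W)" for W
    by (auto simp: openin_mtopology F.openin_mtopology mball)
  moreover have "openin (seminorm_topology (\<lambda>k x. p k (f x))) W \<longleftrightarrow>
      openin (seminorm_topology p) (f ` W)" for W
    by (auto simp: P.openin_iff PF.openin_iff ball)
  ultimately show ?thesis
    by (simp add: topology_eq top)
qed

lemma seminorm_family_pullback:
  assumes "seminorm_family scl' p" "vector_space scl"
    and "\<And>x y. f (x + y) = f x + f y" "\<And>z x. f (scl z x) = scl' z (f x)"
  shows "seminorm_family scl (\<lambda>k x. p k (f x))"
proof -
  interpret P: seminorm_family scl' p by fact
  interpret vector_space scl by fact
  show ?thesis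
    by unfold_locales
      (auto simp: seminorm_def mono_def le_fun_def P.mono_index P.nonneg P.triangle P.scale assms(3,4))
qed

text \<open>Each ingredient is composed with \<open>f\<close>: the metric stays complete because
  \<open>f\<close> is bijective and translation invariant because \<open>f\<close> is additive, and
  submultiplicativity survives because \<open>f\<close> respects products.\<close>

lemma frechet_algebra_pullback:
  assumes "frechet_algebra scl' mul' (seminorm_topology p)" "seminorm_family scl' p"
    and "complex_algebra scl mul" and "bij f"
    and add: "\<And>x y. f (x + y) = f x + f y" and scale: "\<And>z x. f (scl z x) = scl' z (f x)"
    and mult: "\<And>x y. f (mul x y) = mul' (f x) (f y)"
  shows "frechet_algebra scl mul (seminorm_topology (\<lambda>k x. p k (f x)))"
proof -
  interpret T: frechet_algebra scl' mul' "seminorm_topology p" by fact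
  interpret P: seminorm_family scl' p by fact
  interpret complex_algebra scl mul by fact
  note pullback = seminorm_family_pullback[where f = f, OF _ vector_space_axioms add scale]
  interpret PF: seminorm_family scl "\<lambda>k x. p k (f x)"
    by (rule pullback) fact
  have diff: "f (x - y) = f x - f y" for x y
    using add[of "x - y" y] by (simp add: algebra_simps)
  obtain d where d: "Metric_space UNIV d" "\<And>x y z. d (x + z) (y + z) = d x y"
    "Metric_space.mtopology UNIV d = seminorm_topology p" "Metric_space.mcomplete UNIV d"
    using T.complete_metrizable by blast
  interpret frechet_space scl "seminorm_topology (\<lambda>k x. p k (f x))"
  proof (rule PF.frechet_spaceI)
    show "Metric_space UNIV (\<lambda>x y. d (f x) (f y))"
      by (rule Metric_space_pullback[OF d(1) bij_is_inj[OF assms(4)]])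
    show "Metric_space.mtopology UNIV (\<lambda>x y. d (f x) (f y)) = seminorm_topology (\<lambda>k x. p k (f x))"
      by (rule mtopology_pullback) (use d assms(2,4) diff PF.seminorm_family_axioms in auto)
    show "Metric_space.mcomplete UNIV (\<lambda>x y. d (f x) (f y))"
      by (rule mcomplete_pullback[OF d(1) assms(4) d(4)])
  qed (simp add: add d(2))
  obtain p' where p': "mono p'" "\<And>k. seminorm scl' (p' k)" "\<And>k. submultiplicative mul' (p' k)"
    "seminorm_topology p = seminorm_topology p'"
    using T.submultiplicative_seminorms by blast
  have P': "seminorm_family scl' p'"
    by unfold_locales (use p' in auto)
  interpret PF': seminorm_family scl "\<lambda>k x. p' k (f x)"
    by (rule pullback) (rule P')
  \<comment> \<open>The submultiplicative family \<open>p'\<close> may differ from \<open>p\<close>.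
    Both pulled-back families generate the topology of the same pulled-back metric, hence they
    generate the same topology.\<close>
  have "seminorm_topology (\<lambda>k x. p' k (f x)) = seminorm_topology (\<lambda>k x. p k (f x))"
    using mtopology_pullback[OF d(1) assms(4,2) PF.seminorm_family_axioms diff d(3)]
      mtopology_pullback[OF d(1) assms(4) P' PF'.seminorm_family_axioms diff] d(3) p'(4)
    by simp
  then show ?thesis
    using p'(3) PF'.mono_p PF'.seminorm_p
    by unfold_locales
      (auto intro!: exI[of _ "\<lambda>k x. p' k (f x)"] simp: submultiplicative_def mult)
qed

section \<open>The direct sum of algebra and module with its product topology\<close>

lemma vector_space_ext_scale:
  assumes "vector_space scaleA" "vector_space scaleM"
  shows "vector_space (ext_scale scaleA scaleM)"
proof -
  interpret A: vector_space scaleA by fact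
  interpret M: vector_space scaleM by fact
  show ?thesis
    by unfold_locales
      (auto simp: ext_scale_def A.scale_right_distrib A.scale_left_distrib
        M.scale_right_distrib M.scale_left_distrib)
qed

lemma seminorm_family_ext:
  assumes "seminorm_family scaleA pA" "seminorm_family scaleM pM"
  shows "seminorm_family (ext_scale scaleA scaleM) (ext_seminorm pA pM)"
proof -
  interpret A: seminorm_family scaleA pA by fact
  interpret M: seminorm_family scaleM pM by fact
  interpret vector_space "ext_scale scaleA scaleM"
    by (rule vector_space_ext_scale) unfold_locales
  show ?thesis
  proof unfold_locales
    show "mono (ext_seminorm pA pM)"
      by (auto simp: mono_def le_fun_def ext_seminorm_def intro!: add_mono A.mono_index M.mono_index)
    show "seminorm (ext_scale scaleA scaleM) (ext_seminorm pA pM k)" for k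
      unfolding seminorm_def
    proof (intro conjI allI)
      fix u v :: "'a \<times> 'b" and z
      show "0 \<le> ext_seminorm pA pM k u"
        by (auto simp: ext_seminorm_def A.nonneg M.nonneg split: prod.split)
      show "ext_seminorm pA pM k (u + v) \<le> ext_seminorm pA pM k u + ext_seminorm pA pM k v"
        using A.triangle[of k "fst u" "fst v"] M.triangle[of k "snd u" "snd v"]
        by (auto simp: ext_seminorm_def split: prod.split)
      show "ext_seminorm pA pM k (ext_scale scaleA scaleM z u) = cmod z * ext_seminorm pA pM k u"
        by (auto simp: ext_seminorm_def ext_scale_def A.scale M.scale algebra_simps split: prod.split)
    qed
  qed
qed

text \<open>A box of two balls of radius \<open>r / 2\<close> lies in a ball of radius
  \<open>r\<close> for the sum. Conversely a box of balls with indices \<open>i\<close>,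
  \<open>j\<close> and radii \<open>r\<close>, \<open>s\<close> contains the ball of index
  \<open>max i j\<close> and radius \<open>min r s\<close>, as each summand is bounded by the
  sum.\<close>

lemma seminorm_topology_ext:
  assumes "seminorm_family scaleA pA" "seminorm_family scaleM pM"
  shows "seminorm_topology (ext_seminorm pA pM) =
    prod_topology (seminorm_topology pA) (seminorm_topology pM)"
proof -
  interpret A: seminorm_family scaleA pA by fact
  interpret M: seminorm_family scaleM pM by fact
  interpret E: seminorm_family "ext_scale scaleA scaleM" "ext_seminorm pA pM"
    using assms by (rule seminorm_family_ext)
  have "openin (seminorm_topology (ext_seminorm pA pM)) W \<longleftrightarrow>
      openin (prod_topology (seminorm_topology pA) (seminorm_topology pM)) W" for W
  proof
    assume W: "openin (seminorm_topology (ext_seminorm pA pM)) W"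
    show "openin (prod_topology (seminorm_topology pA) (seminorm_topology pM)) W"
      unfolding openin_prod_topology_alt
    proof (intro allI impI)
      fix a x assume "(a, x) \<in> W"
      then obtain k r where r: "0 < r" "{y. ext_seminorm pA pM k (y - (a, x)) < r} \<subseteq> W"
        using W unfolding E.openin_iff by blast
      have "{b. pA k (b - a) < r / 2} \<times> {y. pM k (y - x) < r / 2} \<subseteq> W"
        using r(2) by (auto simp: ext_seminorm_def subset_iff)
      then show "\<exists>U V. openin (seminorm_topology pA) U \<and> openin (seminorm_topology pM) V \<and>
          a \<in> U \<and> x \<in> V \<and> U \<times> V \<subseteq> W"
        using r(1) A.openin_ball[of "r / 2" k a] M.openin_ball[of "r / 2" k x]
        by (intro exI[of _ "{b. pA k (b - a) < r / 2}"] exI[of _ "{y. pM k (y - x) < r / 2}"]) auto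
    qed
  next
    assume W: "openin (prod_topology (seminorm_topology pA) (seminorm_topology pM)) W"
    show "openin (seminorm_topology (ext_seminorm pA pM)) W"
      unfolding E.openin_iff
    proof clarify
      fix a x assume "(a, x) \<in> W"
      then obtain U V where UV: "openin (seminorm_topology pA) U" "openin (seminorm_topology pM) V"
        "a \<in> U" "x \<in> V" "U \<times> V \<subseteq> W"
        using W unfolding openin_prod_topology_alt by meson
      then obtain i r j s where *: "0 < r" "{b. pA i (b - a) < r} \<subseteq> U"
        "0 < s" "{y. pM j (y - x) < s} \<subseteq> V"
        unfolding A.openin_iff M.openin_iff by meson
      have "(b, y) \<in> W" if "ext_seminorm pA pM (max i j) ((b, y) - (a, x)) < min r s" for b y
      proof -
        have "pA i (b - a) < r" "pM j (y - x) < s"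
          using that A.mono_index[of i "max i j" "b - a"] M.mono_index[of j "max i j" "y - x"]
            A.nonneg[of "max i j" "b - a"] M.nonneg[of "max i j" "y - x"]
          by (auto simp: ext_seminorm_def)
        then show ?thesis using *(2,4) UV(5) by blast
      qed
      then have "{u. ext_seminorm pA pM (max i j) (u - (a, x)) < min r s} \<subseteq> W"
        by auto
      then show "\<exists>k r. 0 < r \<and> {u. ext_seminorm pA pM k (u - (a, x)) < r} \<subseteq> W"
        using *(1,3) by (metis min_less_iff_conj)
    qed
  qed
  then show ?thesis by (simp add: topology_eq)
qed

text \<open>The product of two complete translation-invariant metrics is again one, and it induces
  the product topology, which \<open>seminorm_topology_ext\<close> identifies with that of the
  summed seminorms.\<close>

lemma frechet_space_ext:
  assumes "seminorm_family scaleA pA" "seminorm_family scaleM pM"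
    and "frechet_space scaleA (seminorm_topology pA)" "frechet_space scaleM (seminorm_topology pM)"
  shows "frechet_space (ext_scale scaleA scaleM) (seminorm_topology (ext_seminorm pA pM))"
proof -
  obtain d1 where d1: "Metric_space UNIV d1" "\<And>x y z. d1 (x + z) (y + z) = d1 x y"
    "Metric_space.mtopology UNIV d1 = seminorm_topology pA" "Metric_space.mcomplete UNIV d1"
    using frechet_space.complete_metrizable[OF assms(3)] by blast
  obtain d2 where d2: "Metric_space UNIV d2" "\<And>x y z. d2 (x + z) (y + z) = d2 x y"
    "Metric_space.mtopology UNIV d2 = seminorm_topology pM" "Metric_space.mcomplete UNIV d2"
    using frechet_space.complete_metrizable[OF assms(4)] by blast
  interpret Metric_space12 UNIV d1 UNIV d2
    by (simp add: Metric_space12_def d1(1) d2(1))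
  interpret E: seminorm_family "ext_scale scaleA scaleM" "ext_seminorm pA pM"
    using assms(1,2) by (rule seminorm_family_ext)
  show ?thesis
  proof (rule E.frechet_spaceI)
    show "Metric_space UNIV (prod_dist d1 d2)"
      using prod_metric by simp
    show "Metric_space.mtopology UNIV (prod_dist d1 d2) = seminorm_topology (ext_seminorm pA pM)"
      using mtopology_prod_metric
      by (simp add: seminorm_topology_ext[OF assms(1,2)] d1(3) d2(3))
    show "Metric_space.mcomplete UNIV (prod_dist d1 d2)"
      using mcomplete_prod_metric d1(4) d2(4) by simp
    show "prod_dist d1 d2 (x + z) (y + z) = prod_dist d1 d2 x y" for x y z
      by (cases x; cases y; cases z) (simp add: prod_dist_def d1(2) d2(2))
  qed
qed

lemma frechet_algebra_ext:
  assumes module: "comm_algebra_module scaleA mul scaleM act"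
    and pA: "seminorm_family scaleA pA" and pM: "seminorm_family scaleM pM"
    and "frechet_space scaleA (seminorm_topology pA)" "frechet_space scaleM (seminorm_topology pM)"
    and sub: "\<And>k. submultiplicative mul (pA k)"
    and l: "\<And>k. 1 \<le> l k" "\<And>k a x. pM k (act a x) \<le> l k * pA k a * pM k x"
  shows "frechet_algebra (ext_scale scaleA scaleM) (ext_mult mul act)
    (seminorm_topology (ext_seminorm pA pM))"
proof -
  interpret A: seminorm_family scaleA pA by fact
  interpret M: seminorm_family scaleM pM by fact
  interpret E: seminorm_family "ext_scale scaleA scaleM" "ext_seminorm pA pM"
    using pA pM by (rule seminorm_family_ext)
  interpret comm_complex_algebra "ext_scale scaleA scaleM" "ext_mult mul act"
    using module by (rule comm_complex_algebra_ext)
  interpret frechet_space "ext_scale scaleA scaleM" "seminorm_topology (ext_seminorm pA pM)"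
    by (rule frechet_space_ext) fact+
  \<comment> \<open>The running maximum is taken because \<open>l\<close> may fail to be increasing,
    whereas the rescaled seminorms \<open>L k * pA k a\<close> have to increase with
    \<open>k\<close>.\<close>
  define L where "L k = Max (l ` {..k})" for k
  have lL: "l k \<le> L k" for k
    by (simp add: L_def)
  have L1: "1 \<le> L k" for k
    using l(1) lL by (rule order_trans)
  have "mono L"
    by (auto simp: L_def intro!: monoI Max_mono image_mono)
  then have "mono (\<lambda>k a. L k * pA k a)"
    using L1 A.mono_index A.nonneg
    by (auto intro!: monoI le_funI mult_mono simp: order_trans[OF zero_le_one] dest: monoD)
  moreover have "0 \<le> L k" for k
    using L1[of k] by simp
  ultimately have LA: "seminorm_family scaleA (\<lambda>k a. L k * pA k a)"
    by unfold_locales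
      (use A.triangle in \<open>auto simp: seminorm_def A.nonneg A.scale mult_left_mono simp flip: distrib_left\<close>)
  interpret Q: seminorm_family "ext_scale scaleA scaleM" "ext_seminorm (\<lambda>k a. L k * pA k a) pM"
    using LA pM by (rule seminorm_family_ext)
  \<comment> \<open>For each fixed \<open>k\<close> the old and the rescaled seminorm bound each
    other up to the factor \<open>L k\<close>, so rescaling leaves the topology unchanged.\<close>
  have lower: "ext_seminorm pA pM k u \<le> ext_seminorm (\<lambda>k a. L k * pA k a) pM k u"
    and upper: "ext_seminorm (\<lambda>k a. L k * pA k a) pM k u \<le> L k * ext_seminorm pA pM k u" for k u
    using mult_right_mono[OF L1 A.nonneg[of k "fst u"], of k]
      mult_right_mono[OF L1 M.nonneg[of k "snd u"], of k]
    by (auto simp: ext_seminorm_def algebra_simps split: prod.split)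
  have "seminorm_topology (ext_seminorm pA pM) =
      seminorm_topology (ext_seminorm (\<lambda>k a. L k * pA k a) pM)"
    unfolding seminorm_topology_eq_iff[OF E.seminorm_family_axioms Q.seminorm_family_axioms]
  proof (intro conjI allI impI)
    fix k and r :: real assume r: "0 < r"
    have "0 < L k" using L1[of k] by simp
    then show "\<exists>j s. 0 < s \<and> (\<forall>u. ext_seminorm pA pM j u < s \<longrightarrow>
        ext_seminorm (\<lambda>k a. L k * pA k a) pM k u < r)"
      using r upper[of k]
      by (intro exI[of _ k] exI[of _ "r / L k"]) (auto simp: field_simps intro: le_less_trans)
    show "\<exists>j s. 0 < s \<and> (\<forall>u. ext_seminorm (\<lambda>k a. L k * pA k a) pM j u < s \<longrightarrow>
        ext_seminorm pA pM k u < r)"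
      using r lower[of k] by (intro exI[of _ k] exI[of _ r]) (auto intro: le_less_trans)
  qed
  moreover have "submultiplicative (ext_mult mul act) (ext_seminorm (\<lambda>k a. L k * pA k a) pM k)" for k
    unfolding submultiplicative_def
  proof clarify
    fix a x b y
    have act: "pM k (act a x) \<le> L k * pA k a * pM k x" for a x
      using l(2)[of k a x] lL[of k] A.nonneg[of k a] M.nonneg[of k x]
      by (smt (verit) mult_right_mono)
    have "L k * pA k (mul a b) \<le> L k * (pA k a * pA k b)"
      using sub L1[of k] by (auto simp: submultiplicative_def intro!: mult_left_mono)
    \<comment> \<open>A second factor \<open>L k \<ge> 1\<close> is inserted to match the first term
      of the product expanded below.\<close>
    also have "\<dots> \<le> L k * (L k * (pA k a * pA k b))"
      using mult_right_mono[OF L1[of k], of "L k * (pA k a * pA k b)"] L1[of k]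
        A.nonneg[of k a] A.nonneg[of k b] by simp
    finally have "L k * pA k (mul a b) + pM k (act a y + act b x) \<le>
        L k * (L k * (pA k a * pA k b)) + (L k * pA k a * pM k y + L k * pA k b * pM k x)"
      using M.triangle[of k "act a y" "act b x"] act[of a y] act[of b x] by linarith
    \<comment> \<open>Expanding the right-hand side gives the three terms on the left plus the
      nonnegative term \<open>pM k x * pM k y\<close>.\<close>
    also have "\<dots> \<le> (L k * pA k a + pM k x) * (L k * pA k b + pM k y)"
      using mult_nonneg_nonneg[OF M.nonneg[of k x] M.nonneg[of k y]] by (simp add: algebra_simps)
    finally show "ext_seminorm (\<lambda>k a. L k * pA k a) pM k (ext_mult mul act (a, x) (b, y)) \<le>
        ext_seminorm (\<lambda>k a. L k * pA k a) pM k (a, x) * ext_seminorm (\<lambda>k a. L k * pA k a) pM k (b, y)"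
      by (simp add: ext_seminorm_def ext_mult_def)
  qed
  ultimately show ?thesis
    using Q.mono_p Q.seminorm_p by unfold_locales blast
qed

section \<open>The involutive automorphism attached to the derivation\<close>

definition twist :: "('a \<Rightarrow> 'm::ab_group_add) \<Rightarrow> 'a \<times> 'm \<Rightarrow> 'a \<times> 'm" where
  "twist D = (\<lambda>(a, x). (a, D a - x))"

lemma twist_twist [simp]: "twist D (twist D u) = u"
  by (auto simp: twist_def split: prod.split)

lemma ext_seminorm_deriv_eq: "ext_seminorm_deriv pA pM D = (\<lambda>k u. ext_seminorm pA pM k (twist D u))"
  by (auto simp: fun_eq_iff ext_seminorm_deriv_def ext_seminorm_def twist_def)

text \<open>In the module component this is the Leibniz rule:
  \<open>D (mul a b) - (act a y + act b x)\<close> regroups as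
  \<open>act a (D b - y) + act b (D a - x)\<close>.\<close>

lemma twist_mult:
  assumes "comm_algebra_module scaleA mul scaleM act" "derivation scaleA mul scaleM act D"
  shows "twist D (ext_mult mul act u v) = ext_mult mul act (twist D u) (twist D v)"
proof -
  interpret comm_algebra_module scaleA mul scaleM act by fact
  have act_diff: "act a (x - y) = act a x - act a y" for a x y
    using act_add_right[of a "x - y" y] by (simp add: algebra_simps)
  then show ?thesis
    using assms(2)
    by (cases u; cases v) (simp add: twist_def ext_mult_def derivation_def act_diff)
qed

text \<open>The map \<open>D\<close> is recovered from \<open>twist D\<close> on the elements
  \<open>(a, 0)\<close>; in the other direction \<open>twist D\<close> is assembled from
  \<open>D\<close> and the coordinates.\<close>

lemma continuous_map_twist_iff:
  assumes pA: "seminorm_family scaleA pA" and pM: "seminorm_family scaleM pM"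
    and diff: "\<And>a b. D (a - b) = D a - D b"
  shows "continuous_map (seminorm_topology (ext_seminorm pA pM))
      (seminorm_topology (ext_seminorm pA pM)) (twist D) \<longleftrightarrow>
    continuous_map (seminorm_topology pA) (seminorm_topology pM) D"
proof -
  interpret A: seminorm_family scaleA pA by fact
  interpret M: seminorm_family scaleM pM by fact
  have E: "seminorm_family (ext_scale scaleA scaleM) (ext_seminorm pA pM)"
    using pA pM by (rule seminorm_family_ext)
  have twist_diff: "twist D (u - v) = twist D u - twist D v" for u v
    by (auto simp: twist_def diff split: prod.split)
  note iff = continuous_map_seminorm_topology[where f = "twist D", OF E E twist_diff]
    continuous_map_seminorm_topology[where f = D, OF pA pM diff]
  show ?thesis
    unfolding iff
  proof (intro iffI allI impI)
    fix k and r :: real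
    assume *: "\<forall>k r. 0 < r \<longrightarrow> (\<exists>j s. 0 < s \<and>
      (\<forall>u. ext_seminorm pA pM j u < s \<longrightarrow> ext_seminorm pA pM k (twist D u) < r))"
    assume r: "0 < r"
    obtain j s where s: "0 < s" and
      js: "\<And>u. ext_seminorm pA pM j u < s \<Longrightarrow> ext_seminorm pA pM k (twist D u) < r"
      using * r by metis
    \<comment> \<open>The test element \<open>(a, 0)\<close> has \<open>ext_seminorm\<close> equal
      to \<open>pA j a\<close>, and its image is \<open>(a, D a)\<close>.\<close>
    have "pM k (D a) < r" if "pA j a < s" for a
      using js[of "(a, 0)"] that A.nonneg[of k a] by (simp add: ext_seminorm_def twist_def)
    then show "\<exists>j s. 0 < s \<and> (\<forall>a. pA j a < s \<longrightarrow> pM k (D a) < r)"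
      using s by blast
  next
    fix k and r :: real
    assume *: "\<forall>k r. 0 < r \<longrightarrow> (\<exists>j s. 0 < s \<and> (\<forall>a. pA j a < s \<longrightarrow> pM k (D a) < r))"
    assume r: "0 < r"
    obtain j s where s: "0 < s" and js: "\<And>a. pA j a < s \<Longrightarrow> pM k (D a) < r / 2"
      using * r by (metis half_gt_zero)
    \<comment> \<open>One half of \<open>r\<close> pays for \<open>D a\<close>, the other for
      \<open>pA k a + pM k x\<close>. The index \<open>max j k\<close> controls both the hypothesis
      on \<open>pA j a\<close> and this sum.\<close>
    have "ext_seminorm pA pM k (twist D (a, x)) < r"
      if "ext_seminorm pA pM (max j k) (a, x) < min s (r / 2)" for a x
    proof -
      have "pA (max j k) a + pM (max j k) x < min s (r / 2)"
        using that by (simp add: ext_seminorm_def)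
      then have "pA j a < s" "pA k a + pM k x < r / 2"
        using A.mono_index[of j "max j k" a] A.mono_index[of k "max j k" a]
          M.mono_index[of k "max j k" x] M.nonneg[of "max j k" x] by auto
      then show ?thesis
        using js[of a] M.triangle_diff[of k "D a" x] by (simp add: ext_seminorm_def twist_def)
    qed
    then show "\<exists>j s. 0 < s \<and>
        (\<forall>u. ext_seminorm pA pM j u < s \<longrightarrow> ext_seminorm pA pM k (twist D u) < r)"
      using s r by (intro exI[of _ "max j k"] exI[of _ "min s (r / 2)"]) auto
  qed
qed

theorem theorem2p3:
  fixes scaleA :: "complex \<Rightarrow> 'a::ab_group_add \<Rightarrow> 'a"
    and mul :: "'a \<Rightarrow> 'a \<Rightarrow> 'a"
    and TA :: "'a topology"
    and scaleM :: "complex \<Rightarrow> 'm::ab_group_add \<Rightarrow> 'm"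
    and act :: "'a \<Rightarrow> 'm \<Rightarrow> 'm"
    and TM :: "'m topology"
    and pA :: "nat \<Rightarrow> 'a \<Rightarrow> real"
    and pM :: "nat \<Rightarrow> 'm \<Rightarrow> real"
    and l :: "nat \<Rightarrow> real"
    and D :: "'a \<Rightarrow> 'm"
  assumes "comm_frechet_algebra scaleA mul TA"
    and "comm_frechet_module scaleA mul TA scaleM act TM"
    and "mono pA" "\<And>k. seminorm scaleA (pA k)" "\<And>k. submultiplicative mul (pA k)"
    and "TA = seminorm_topology pA"
    and "mono pM" "\<And>k. seminorm scaleM (pM k)"
    and "TM = seminorm_topology pM"
    and "\<And>k. 1 \<le> l k" "\<And>k a x. pM k (act a x) \<le> l k * pA k a * pM k x"
    and "derivation scaleA mul scaleM act D"
  shows "frechet_algebra (ext_scale scaleA scaleM) (ext_mult mul act)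
           (seminorm_topology (ext_seminorm pA pM)) \<and>
         frechet_algebra (ext_scale scaleA scaleM) (ext_mult mul act)
           (seminorm_topology (ext_seminorm_deriv pA pM D)) \<and>
         (seminorm_topology (ext_seminorm pA pM) = seminorm_topology (ext_seminorm_deriv pA pM D)
            \<longleftrightarrow> continuous_map TA TM D)"
proof -
  interpret comm_frechet_module scaleA mul TA scaleM act TM by fact
  have module: "comm_algebra_module scaleA mul scaleM act" ..
  have pA: "seminorm_family scaleA pA"
    by unfold_locales (use assms(3,4) in auto)
  have pM: "seminorm_family scaleM pM"
    by unfold_locales (use assms(7,8) in auto)
  interpret U: comm_complex_algebra "ext_scale scaleA scaleM" "ext_mult mul act"
    using module by (rule comm_complex_algebra_ext)
  have E: "seminorm_family (ext_scale scaleA scaleM) (ext_seminorm pA pM)"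
    using pA pM by (rule seminorm_family_ext)
  interpret D: Vector_Spaces.linear scaleA scaleM D
    using assms(12) by (simp add: derivation_def)
  have twist_add: "twist D (u + v) = twist D u + twist D v" for u v
    by (auto simp: twist_def D.add split: prod.split)
  have twist_diff: "twist D (u - v) = twist D u - twist D v" for u v
    by (auto simp: twist_def D.diff split: prod.split)
  have twist_scale: "twist D (ext_scale scaleA scaleM z u) = ext_scale scaleA scaleM z (twist D u)"
    for z u
    by (auto simp: twist_def ext_scale_def D.scale M.scale_right_diff_distrib split: prod.split)
  have ED: "seminorm_family (ext_scale scaleA scaleM) (\<lambda>k u. ext_seminorm pA pM k (twist D u))"
    by (rule seminorm_family_pullback[where f = "twist D", OF E U.vector_space_axioms twist_add twist_scale])
  have 1: "frechet_algebra (ext_scale scaleA scaleM) (ext_mult mul act)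
      (seminorm_topology (ext_seminorm pA pM))"
    by (rule frechet_algebra_ext[OF module pA pM _ _ assms(5,10,11)])
      (use A.frechet_space_axioms M.frechet_space_axioms assms(6,9) in auto)
  have "bij (twist D)"
    by (rule involuntory_imp_bij) simp
  \<comment> \<open>Since \<open>twist D\<close> is a bijective algebra homomorphism of the
    extension to itself, the first Frechet algebra structure pulls back to the second on the same
    algebra.\<close>
  then have 2: "frechet_algebra (ext_scale scaleA scaleM) (ext_mult mul act)
      (seminorm_topology (ext_seminorm_deriv pA pM D))"
    unfolding ext_seminorm_deriv_eq
    by (rule frechet_algebra_pullback[OF 1 E U.complex_algebra_axioms])
      (auto simp: twist_add twist_scale twist_mult[OF module assms(12)])
  \<comment> \<open>The involution criterion reduces equality of the topologies to continuity of
    \<open>twist D\<close> for the product topology, which is equivalent to continuity of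
    \<open>D\<close>.\<close>
  have "seminorm_topology (ext_seminorm pA pM) = seminorm_topology (ext_seminorm_deriv pA pM D)
      \<longleftrightarrow> continuous_map TA TM D"
    unfolding ext_seminorm_deriv_eq assms(6,9)
      seminorm_topology_involution_eq_iff[where \<phi> = "twist D", OF E ED twist_diff twist_twist]
    by (rule continuous_map_twist_iff[where D = D, OF pA pM D.diff])
  with 1 2 show ?thesis by blast
qed

end
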